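(* Let $n\ge 1$ be an integer and let $X$ be a metric space with $\operatorname{asdim} X\ge n$ and $\operatorname{St} X\neq\{1\}$. Let $A$ be a metric space and $r$ a real number. Suppose that for some integer $k$ with $1\le k\le n$ there exist $r$-disjoint families $\mathcal{U}^1,\ldots,\mathcal{U}^k$ of uniformly bounded subsets of $A$ such that every point of $A$ belongs to some member of one of the families $\mathcal{U}^1,\ldots,\mathcal{U}^k$. Then $$d_{GH}(A,X)\ge \frac{r}{2}.$$
   Context: Metric spaces are non-empty and not assumed bounded; a metric takes finite values. For non-empty subsets $B,C$ of a metric space $Z$ put $d(B,C)=\inf\{d_Z(b,c) : b\in B,\ c\in C\}$. A family $\mathcal{U}=\{U_\alpha\}_\alpha$ of (non-empty) subsets of a metric space is called $r$-disjoint if $d(U_\alpha,U_\beta)>r$ for all $\alpha\ne\beta$. A family consists of uniformly bounded subsets if there is a finite constant $C$ such that every member has diameter less than $C$. Asymptotic dimension: for an integer $m\ge 0$, $\operatorname{asdim}X\le m$ means that for every $r<\infty$ there exist $r$-disjoint families $\mathcal{U}^0,\ldots,\mathcal{U}^m$ of uniformly bounded subsets of $X$ such that $\bigcup_i\mathcal{U}^i$ is a cover of $X$. For $n\ge1$, $\operatorname{asdim}X\ge n$ means that $\operatorname{asdim}X\le n-1$ does not hold. Stabilizer: for $\lambda>0$, $\lambda X$ denotes the set $X$ with the metric $\lambda d_X$. The stabilizer of $X$ is $\operatorname{St}X=\{\lambda\in\mathbb{R}_{>0} : \lambda X \text{ is isometric to } X\}$; it is a subgroup of the multiplicative group $\mathbb{R}_{>0}$,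 whose identity element is $1$. The Hausdorff distance between non-empty subsets $B,C$ of a metric space is $d_H(B,C)=\inf\{s>0 : B\subset U_s(C),\ C\subset U_s(B)\}$, where $U_s(B)$ is the open $s$-neighborhood of $B$, i.e. the union of the open balls of radius $s$ centered at points of $B$. The Gromov--Hausdorff distance $d_{GH}(X,Y)$ between metric spaces $X$ and $Y$ is the infimum of the numbers $s\ge 0$ for which there exist a metric space $Z$ and subsets $X',Y'\subset Z$, isometric to $X$ and $Y$ respectively, such that $d_H(X',Y')\le s$ (it equals $\infty$ if there is no such $s$). *)

theory Defs
  imports "HOL-Analysis.Analysis"
begin

definition scale_metric :: "real \<Rightarrow> 'a metric \<Rightarrow> 'a metric" where
  "scale_metric c X = metric (mspace X, \<lambda>x y. c * mdist X x y)"

lemma Metric_space_scale: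
  assumes "c > 0"
  shows "Metric_space (mspace X) (\<lambda>x y. c * mdist X x y)"
proof
  fix x y z
  assume "x \<in> mspace X" "y \<in> mspace X" "z \<in> mspace X"
  then have "mdist X x z \<le> mdist X x y + mdist X y z"
    by (rule mdist_triangle)
  then show "c * mdist X x z \<le> c * mdist X x y + c * mdist X y z"
    using assms by (metis distrib_left less_eq_real_def mult_left_mono)
qed (use assms in \<open>auto simp: mdist_commute\<close>)

lemma mspace_scale_metric [simp]: "c > 0 \<Longrightarrow> mspace (scale_metric c X) = mspace X"
  by (simp add: scale_metric_def Metric_space.mspace_metric Metric_space_scale)

lemma mdist_scale_metric [simp]:
  "c > 0 \<Longrightarrow> mdist (scale_metric c X) = (\<lambda>x y. c * mdist X x y)"
  by (simp add: scale_metric_def Metric_space.mdist_metric Metric_space_scale)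

definition isometric :: "'a metric \<Rightarrow> 'b metric \<Rightarrow> bool" where
  "isometric X Y \<longleftrightarrow> (\<exists>f. bij_betw f (mspace X) (mspace Y) \<and>
     (\<forall>x\<in>mspace X. \<forall>y\<in>mspace X. mdist Y (f x) (f y) = mdist X x y))"

definition stabilizer :: "'a metric \<Rightarrow> real set" where
  "stabilizer X = {c. c > 0 \<and> isometric (scale_metric c X) X}"

definition set_mdist :: "'a metric \<Rightarrow> 'a set \<Rightarrow> 'a set \<Rightarrow> ereal" where
  "set_mdist X B C = (INF b\<in>B. INF c\<in>C. ereal (mdist X b c))"

text \<open>Taken in \<^typ>\<open>ereal\<close>, so that unbounded sets have diameter \<open>\<infinity>\<close>; the library's
  \<^const>\<open>diameter\<close> is a real number.\<close>

definition mdiameter :: "'a metric \<Rightarrow> 'a set \<Rightarrow> ereal" where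
  "mdiameter X B = (SUP b\<in>B. SUP c\<in>B. ereal (mdist X b c))"

definition subset_family :: "'a metric \<Rightarrow> 'a set set \<Rightarrow> bool" where
  "subset_family X \<U> \<longleftrightarrow> (\<forall>U\<in>\<U>. U \<noteq> {} \<and> U \<subseteq> mspace X)"

definition r_disjoint :: "'a metric \<Rightarrow> real \<Rightarrow> 'a set set \<Rightarrow> bool" where
  "r_disjoint X r \<U> \<longleftrightarrow> (\<forall>U\<in>\<U>. \<forall>V\<in>\<U>. U \<noteq> V \<longrightarrow> set_mdist X U V > ereal r)"

definition uniformly_bounded :: "'a metric \<Rightarrow> 'a set set \<Rightarrow> bool" where
  "uniformly_bounded X \<U> \<longleftrightarrow> (\<exists>C::real. \<forall>U\<in>\<U>. mdiameter X U < ereal C)"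

definition asdim_le :: "'a metric \<Rightarrow> nat \<Rightarrow> bool" where
  "asdim_le X m \<longleftrightarrow> (\<forall>r::real. \<exists>\<U>::nat \<Rightarrow> 'a set set.
     (\<forall>i\<in>{0..m}. subset_family X (\<U> i) \<and> r_disjoint X r (\<U> i) \<and> uniformly_bounded X (\<U> i)) \<and>
     mspace X \<subseteq> \<Union>(\<Union>i\<in>{0..m}. \<U> i))"

definition asdim_ge :: "'a metric \<Rightarrow> nat \<Rightarrow> bool" where
  "asdim_ge X n \<longleftrightarrow> n = 0 \<or> \<not> asdim_le X (n - 1)"

definition nbhd :: "'a metric \<Rightarrow> real \<Rightarrow> 'a set \<Rightarrow> 'a set" where
  "nbhd Z s B = (\<Union>b\<in>B. mball_of Z b s)"

definition hausdorff_mdist :: "'a metric \<Rightarrow> 'a set \<Rightarrow> 'a set \<Rightarrow> ereal" where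
  "hausdorff_mdist Z B C =
     Inf {ereal s | s. s > 0 \<and> B \<subseteq> nbhd Z s C \<and> C \<subseteq> nbhd Z s B}"

definition GH_realized :: "'c metric \<Rightarrow> 'a metric \<Rightarrow> 'b metric \<Rightarrow> real \<Rightarrow> bool" where
  "GH_realized Z X Y s \<longleftrightarrow> (\<exists>X' Y'. X' \<subseteq> mspace Z \<and> Y' \<subseteq> mspace Z \<and>
     isometric (submetric Z X') X \<and> isometric (submetric Z Y') Y \<and>
     hausdorff_mdist Z X' Y' \<le> ereal s)"

text \<open>A formula cannot quantify over the type of the ambient space \<open>Z\<close>. Carriers inside the sum
  type suffice, since \<open>Z\<close> may be replaced by \<open>X' \<union> Y'\<close>; the lemma \<open>GH_realized_sum_type\<close> below
  shows that an ambient space over any other type gives nothing more.\<close>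

definition GH_dist :: "'a metric \<Rightarrow> 'b metric \<Rightarrow> ereal" where
  "GH_dist X Y = Inf {ereal s | s. s \<ge> 0 \<and> (\<exists>Z::('a + 'b) metric. GH_realized Z X Y s)}"

lemma GH_realized_sum_type:
  fixes Z :: "'c metric" and X :: "'a metric" and Y :: "'b metric"
  assumes "GH_realized Z X Y s"
  shows "\<exists>Z'::('a + 'b) metric. GH_realized Z' X Y s"
proof -
  obtain X' Y' f g where sub: "X' \<subseteq> mspace Z" "Y' \<subseteq> mspace Z"
    and f: "bij_betw f X' (mspace X)" "\<And>x y. x \<in> X' \<Longrightarrow> y \<in> X' \<Longrightarrow> mdist X (f x) (f y) = mdist Z x y"
    and g: "bij_betw g Y' (mspace Y)" "\<And>x y. x \<in> Y' \<Longrightarrow> y \<in> Y' \<Longrightarrow> mdist Y (g x) (g y) = mdist Z x y"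
    and H: "hausdorff_mdist Z X' Y' \<le> ereal s"
    using assms unfolding GH_realized_def isometric_def
    by (auto simp: Int_absorb2)
  define W where "W = X' \<union> Y'"
  define h where "h = (\<lambda>z. if z \<in> X' then Inl (f z) else Inr (g z) :: 'a + 'b)"
  define k where "k = inv_into W h"
  have "inj_on h W"
    using f(1) g(1) unfolding inj_on_def h_def W_def bij_betw_def by auto
  then have kh [simp]: "k (h z) = z" if "z \<in> W" for z
    using that by (simp add: k_def)
  have W: "W \<subseteq> mspace Z" using sub by (auto simp: W_def)
  have M: "Metric_space (h ` W) (\<lambda>u v. mdist Z (k u) (k v))"
  proof
    show "mdist Z (k u) (k v) = mdist Z (k v) (k u)" for u v
      by (rule mdist_commute)
    show "mdist Z (k u) (k v) = 0 \<longleftrightarrow> u = v" if "u \<in> h ` W" "v \<in> h ` W" for u v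
      using that W by (auto simp: subset_iff)
    show "mdist Z (k u) (k w) \<le> mdist Z (k u) (k v) + mdist Z (k v) (k w)"
      if "u \<in> h ` W" "v \<in> h ` W" "w \<in> h ` W" for u v w
      using that W by (auto intro!: mdist_triangle simp: subset_iff)
  qed auto
  define Z' where "Z' = metric (h ` W, \<lambda>u v. mdist Z (k u) (k v))"
  have Z' [simp]: "mspace Z' = h ` W" "mdist Z' = (\<lambda>u v. mdist Z (k u) (k v))"
    using M by (auto simp: Z'_def Metric_space.mspace_metric Metric_space.mdist_metric)
  have iso: "isometric (submetric Z' (h ` T)) V"
    if "T \<subseteq> W" "bij_betw p T (mspace V)"
      "\<And>x y. x \<in> T \<Longrightarrow> y \<in> T \<Longrightarrow> mdist V (p x) (p y) = mdist Z x y"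
    for T p and V :: "'d metric"
  proof -
    have "bij_betw k (h ` T) T"
      using that(1) by (intro bij_betw_byWitness[of _ h]) (auto simp: subset_iff)
    then have "bij_betw (p \<circ> k) (h ` T) (mspace V)"
      using that(2) bij_betw_trans by blast
    moreover have "mspace (submetric Z' (h ` T)) = h ` T"
      using that(1) by auto
    ultimately show ?thesis
      unfolding isometric_def using that(1,3)
      by (intro exI[of _ "p \<circ> k"]) (auto simp: subset_iff)
  qed
  have nb: "h ` S \<subseteq> nbhd Z' t (h ` T)" if "S \<subseteq> W" "T \<subseteq> W" "S \<subseteq> nbhd Z t T" for S T t
  proof
    fix u assume "u \<in> h ` S"
    then obtain x where x: "x \<in> S" "u = h x" by blast
    then obtain y where y: "y \<in> T" "mdist Z y x < t"
      using \<open>S \<subseteq> nbhd Z t T\<close> by (auto simp: nbhd_def)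
    have "h x \<in> mball_of Z' (h y) t"
      using x y that by (auto simp: subset_iff)
    then show "u \<in> nbhd Z' t (h ` T)"
      using x y by (auto simp: nbhd_def)
  qed
  have "hausdorff_mdist Z' (h ` X') (h ` Y') \<le> hausdorff_mdist Z X' Y'"
    unfolding hausdorff_mdist_def
    by (rule Inf_superset_mono) (auto intro!: nb[THEN subsetD] simp: W_def)
  then have "hausdorff_mdist Z' (h ` X') (h ` Y') \<le> ereal s"
    using H by (rule order_trans)
  moreover have "isometric (submetric Z' (h ` X')) X"
    using f by (intro iso) (auto simp: W_def)
  moreover have "isometric (submetric Z' (h ` Y')) Y"
    using g by (intro iso) (auto simp: W_def)
  ultimately have "GH_realized Z' X Y s"
    unfolding GH_realized_def by (intro exI[of _ "h ` X'"] exI[of _ "h ` Y'"]) (auto simp: W_def)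
  then show ?thesis ..
qed

end

theory Submission
  imports Defs
begin

text \<open>
  If \<open>A\<close> and \<open>X\<close> are at Gromov--Hausdorff distance less than \<open>r / 2\<close>, then they are matched by a
  correspondence that changes distances by at most some \<open>e < r\<close>. Replacing each member of the
  families in \<open>A\<close> by the set of points of \<open>X\<close> that correspond to its points costs at most \<open>e\<close> in
  the separation and in the diameters, so \<open>X\<close> is covered by \<open>n\<close> uniformly bounded families whose
  separation \<open>\<delta> = (r - e) / 2\<close> is positive.

  A positive separation is all that is needed, because a nontrivial stabilizer provides a bijection
  of \<open>X\<close> that multiplies all distances by some \<open>c > 1\<close>. Its iterates carry the cover to covers of the
  same kind with separation \<open>c ^ N * \<delta>\<close>, which exceeds any bound. Hence \<open>asdim X \<le> n - 1\<close>, contrary to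
  the assumption on \<open>X\<close>.

  Both transports of covers, along the correspondence and along the iterated similarity, are
  instances of one lemma, \<open>layered_cover_transport\<close>, about relations that distort distances in an
  affinely bounded way.
\<close>

section \<open>Covers at one scale and their transport\<close>

definition correspondence :: "'a metric \<Rightarrow> 'b metric \<Rightarrow> ('a \<Rightarrow> 'b \<Rightarrow> bool) \<Rightarrow> bool" where
  "correspondence X Y S \<longleftrightarrow>
     (\<forall>x y. S x y \<longrightarrow> x \<in> mspace X \<and> y \<in> mspace Y) \<and>
     (\<forall>x\<in>mspace X. \<exists>y. S x y) \<and> (\<forall>y\<in>mspace Y. \<exists>x. S x y)"

text \<open>The condition that \<^const>\<open>asdim_le\<close> imposes at one fixed scale \<open>r\<close>, isolated because the argument
  produces a cover at a single scale before it changes the scale.\<close>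

definition layered_cover :: "'a metric \<Rightarrow> nat \<Rightarrow> real \<Rightarrow> bool" where
  "layered_cover X m r \<longleftrightarrow> (\<exists>\<U>::nat \<Rightarrow> 'a set set.
     (\<forall>i\<in>{0..m}. subset_family X (\<U> i) \<and> r_disjoint X r (\<U> i) \<and> uniformly_bounded X (\<U> i)) \<and>
     mspace X \<subseteq> \<Union>(\<Union>i\<in>{0..m}. \<U> i))"

lemma asdim_le_iff_layered_cover: "asdim_le X m \<longleftrightarrow> (\<forall>r. layered_cover X m r)"
  by (simp add: asdim_le_def layered_cover_def)

lemma layered_coverE:
  assumes "layered_cover X m r"
  obtains \<U> where
    "\<And>i. i \<le> m \<Longrightarrow> subset_family X (\<U> i) \<and> r_disjoint X r (\<U> i) \<and> uniformly_bounded X (\<U> i)"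
    "mspace X \<subseteq> \<Union>(\<Union>i\<in>{0..m}. \<U> i)"
proof -
  obtain \<U> where "\<forall>i\<in>{0..m}.
      subset_family X (\<U> i) \<and> r_disjoint X r (\<U> i) \<and> uniformly_bounded X (\<U> i)"
    "mspace X \<subseteq> \<Union>(\<Union>i\<in>{0..m}. \<U> i)"
    using assms unfolding layered_cover_def by blast
  then show ?thesis
    using that[of \<U>] by simp
qed

lemma layered_cover_mono:
  assumes "layered_cover X m r" "m \<le> m'"
  shows "layered_cover X m' r"
proof -
  obtain \<U> where \<U>: "\<And>i. i \<le> m \<Longrightarrow>
      subset_family X (\<U> i) \<and> r_disjoint X r (\<U> i) \<and> uniformly_bounded X (\<U> i)"
    and cover: "mspace X \<subseteq> \<Union>(\<Union>i\<in>{0..m}. \<U> i)"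
    using assms(1) by (rule layered_coverE) blast
  define \<V> where "\<V> i = (if i \<le> m then \<U> i else {})" for i
  have "subset_family X (\<V> i) \<and> r_disjoint X r (\<V> i) \<and> uniformly_bounded X (\<V> i)" for i
    using \<U>[of i]
    by (cases "i \<le> m") (auto simp: \<V>_def subset_family_def r_disjoint_def uniformly_bounded_def)
  moreover have "mspace X \<subseteq> \<Union>(\<Union>i\<in>{0..m'}. \<V> i)"
  proof
    fix x assume "x \<in> mspace X"
    then obtain i U where "i \<le> m" "U \<in> \<U> i" "x \<in> U"
      using cover by auto
    then show "x \<in> \<Union>(\<Union>i\<in>{0..m'}. \<V> i)"
      using assms(2) by (auto simp: \<V>_def intro!: bexI[of _ i])
  qed
  ultimately show ?thesis
    unfolding layered_cover_def by blast
qed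

lemma r_disjointD:
  assumes "r_disjoint X r \<U>" "U \<in> \<U>" "V \<in> \<U>" "U \<noteq> V" "x \<in> U" "y \<in> V"
  shows "mdist X x y > r"
proof -
  have "ereal r < set_mdist X U V"
    using assms(1-4) by (simp add: r_disjoint_def)
  also have "\<dots> \<le> ereal (mdist X x y)"
    unfolding set_mdist_def using assms(5,6) by (meson INF_lower INF_lower2)
  finally show ?thesis by simp
qed

text \<open>The margin between \<open>r\<close> and \<open>t\<close> is there because strict bounds on the distances of points do not
  survive the infimum in \<^const>\<open>set_mdist\<close>.\<close>

lemma r_disjointI:
  assumes "r < t"
    and "\<And>U V x y. U \<in> \<U> \<Longrightarrow> V \<in> \<U> \<Longrightarrow> U \<noteq> V \<Longrightarrow> x \<in> U \<Longrightarrow> y \<in> V \<Longrightarrow> t \<le> mdist X x y"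
  shows "r_disjoint X r \<U>"
  unfolding r_disjoint_def
proof (intro ballI impI)
  fix U V assume "U \<in> \<U>" "V \<in> \<U>" "U \<noteq> V"
  then have "ereal t \<le> set_mdist X U V"
    unfolding set_mdist_def using assms(2) by (intro INF_greatest) auto
  then show "ereal r < set_mdist X U V"
    using assms(1) by (meson ereal_less_le less_ereal.simps(1) order_less_le_trans)
qed

lemma uniformly_bounded_iff:
  "uniformly_bounded X \<U> \<longleftrightarrow> (\<exists>C. \<forall>U\<in>\<U>. \<forall>x\<in>U. \<forall>y\<in>U. mdist X x y \<le> C)"
proof
  assume "uniformly_bounded X \<U>"
  then obtain C where C: "\<And>U. U \<in> \<U> \<Longrightarrow> mdiameter X U < ereal C"
    by (auto simp: uniformly_bounded_def)
  have "mdist X x y \<le> C" if "U \<in> \<U>" "x \<in> U" "y \<in> U" for U x y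
  proof -
    have "ereal (mdist X x y) \<le> mdiameter X U"
      unfolding mdiameter_def using that(2,3) by (meson SUP_upper SUP_upper2)
    then have "ereal (mdist X x y) < ereal C"
      using C[OF that(1)] by (rule order_le_less_trans)
    then show ?thesis by simp
  qed
  then show "\<exists>C. \<forall>U\<in>\<U>. \<forall>x\<in>U. \<forall>y\<in>U. mdist X x y \<le> C" by blast
next
  assume "\<exists>C. \<forall>U\<in>\<U>. \<forall>x\<in>U. \<forall>y\<in>U. mdist X x y \<le> C"
  then obtain C where C: "\<And>U x y. U \<in> \<U> \<Longrightarrow> x \<in> U \<Longrightarrow> y \<in> U \<Longrightarrow> mdist X x y \<le> C"
    by blast
  have "mdiameter X U < ereal (C + 1)" if "U \<in> \<U>" for U
  proof -
    have "mdiameter X U \<le> ereal C"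
      unfolding mdiameter_def using C[OF that] by (intro SUP_least) auto
    also have "\<dots> < ereal (C + 1)" by simp
    finally show ?thesis .
  qed
  then show "uniformly_bounded X \<U>"
    unfolding uniformly_bounded_def by blast
qed

text \<open>Each member \<open>U\<close> is replaced by the set \<open>V U\<close> of all points related to it. Two different sets \<open>V U\<close>
  come from different members \<open>U\<close>, so the lower distance bound controls the separation and the
  upper one the diameters.\<close>

lemma layered_cover_transport:
  fixes X :: "'a metric" and Y :: "'b metric"
  assumes cover: "layered_cover X m r" and S: "correspondence X Y S"
    and "c > 0" and "t < c * r - e"
    and dist: "\<And>x x' y y'. S x y \<Longrightarrow> S x' y' \<Longrightarrow>
           \<bar>mdist Y y y' - c * mdist X x x'\<bar> \<le> e"
  shows "layered_cover Y m t"
proof -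
  obtain \<U> where \<U>: "\<And>i. i \<le> m \<Longrightarrow>
      subset_family X (\<U> i) \<and> r_disjoint X r (\<U> i) \<and> uniformly_bounded X (\<U> i)"
    and cov: "mspace X \<subseteq> \<Union>(\<Union>i\<in>{0..m}. \<U> i)"
    using cover by (rule layered_coverE) blast
  define V where "V U = {y. \<exists>x\<in>U. S x y}" for U
  have "subset_family Y (V ` \<U> i) \<and> r_disjoint Y t (V ` \<U> i) \<and> uniformly_bounded Y (V ` \<U> i)"
    if i: "i \<le> m" for i
  proof (intro conjI)
    show "subset_family Y (V ` \<U> i)"
      unfolding subset_family_def
    proof
      fix P assume "P \<in> V ` \<U> i"
      then obtain U where U: "U \<in> \<U> i" "P = V U" by blast
      then obtain x where "x \<in> U" "x \<in> mspace X"
        using \<U>[OF i] by (auto simp: subset_family_def)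
      then show "P \<noteq> {} \<and> P \<subseteq> mspace Y"
        using U(2) S unfolding V_def correspondence_def by blast
    qed
    show "r_disjoint Y t (V ` \<U> i)"
    proof (rule r_disjointI[OF \<open>t < c * r - e\<close>])
      fix P Q y y' assume "P \<in> V ` \<U> i" "Q \<in> V ` \<U> i" "P \<noteq> Q" "y \<in> P" "y' \<in> Q"
      then obtain U W where UW: "U \<in> \<U> i" "W \<in> \<U> i" "U \<noteq> W" "y \<in> V U" "y' \<in> V W"
        by blast
      obtain x x' where x: "x \<in> U" "x' \<in> W" "S x y" "S x' y'"
        using UW(4,5) unfolding V_def by blast
      have "r < mdist X x x'"
        using \<U>[OF i] UW(1-3) x(1,2) by (auto intro: r_disjointD)
      then have "c * r \<le> c * mdist X x x'"
        using \<open>c > 0\<close> by simp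
      then show "c * r - e \<le> mdist Y y y'"
        using dist[OF x(3,4)] by linarith
    qed
    obtain C where C: "\<And>U x x'. U \<in> \<U> i \<Longrightarrow> x \<in> U \<Longrightarrow> x' \<in> U \<Longrightarrow> mdist X x x' \<le> C"
      using \<U>[OF i] unfolding uniformly_bounded_iff by blast
    have "mdist Y y y' \<le> c * C + e" if "U \<in> \<U> i" "y \<in> V U" "y' \<in> V U" for U y y'
    proof -
      obtain x x' where *: "x \<in> U" "x' \<in> U" "S x y" "S x' y'"
        using \<open>y \<in> V U\<close> \<open>y' \<in> V U\<close> unfolding V_def by blast
      have "c * mdist X x x' \<le> c * C"
        using C[OF \<open>U \<in> \<U> i\<close> *(1,2)] \<open>c > 0\<close> by simp
      then show ?thesis
        using dist[OF *(3,4)] by linarith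
    qed
    then show "uniformly_bounded Y (V ` \<U> i)"
      unfolding uniformly_bounded_iff by (intro exI[of _ "c * C + e"]) auto
  qed
  moreover have "mspace Y \<subseteq> \<Union>(\<Union>i\<in>{0..m}. V ` \<U> i)"
  proof
    fix y assume "y \<in> mspace Y"
    then obtain x where "S x y" "x \<in> mspace X"
      using S by (auto simp: correspondence_def)
    then obtain i U where "i \<le> m" "U \<in> \<U> i" "x \<in> U"
      using cov by auto
    moreover from this have "y \<in> V U"
      using \<open>S x y\<close> by (auto simp: V_def)
    ultimately show "y \<in> \<Union>(\<Union>i\<in>{0..m}. V ` \<U> i)"
      by auto
  qed
  ultimately show ?thesis
    unfolding layered_cover_def by (intro exI[of _ "\<lambda>i. V ` \<U> i"]) simp
qed

section \<open>Correspondences from the Gromov--Hausdorff distance\<close>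

text \<open>In the common ambient space, two points correspond when they are closer than a bound on the
  Hausdorff distance; the triangle inequality is then used at both ends of a segment, whence the
  factor \<open>2\<close>.\<close>

lemma correspondence_of_GH_dist_less:
  fixes X :: "'a metric" and Y :: "'b metric"
  assumes "GH_dist X Y < ereal q"
  obtains S s where "s < q" "correspondence X Y S"
    "\<And>x x' y y'. S x y \<Longrightarrow> S x' y' \<Longrightarrow> \<bar>mdist Y y y' - mdist X x x'\<bar> \<le> 2 * s"
proof -
  obtain s0 and Z :: "('a + 'b) metric" where "s0 < q" "GH_realized Z X Y s0"
    using assms unfolding GH_dist_def Inf_less_iff by auto
  then obtain X' Y' f g where sub: "X' \<subseteq> mspace Z" "Y' \<subseteq> mspace Z"
    and f: "bij_betw f X' (mspace X)"
      "\<And>p q. p \<in> X' \<Longrightarrow> q \<in> X' \<Longrightarrow> mdist X (f p) (f q) = mdist Z p q"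
    and g: "bij_betw g Y' (mspace Y)"
      "\<And>p q. p \<in> Y' \<Longrightarrow> q \<in> Y' \<Longrightarrow> mdist Y (g p) (g q) = mdist Z p q"
    and "hausdorff_mdist Z X' Y' \<le> ereal s0"
    unfolding GH_realized_def isometric_def by (auto simp: Int_absorb2)
  then have "hausdorff_mdist Z X' Y' < ereal q"
    using \<open>s0 < q\<close> by (meson le_less_trans less_ereal.simps(1))
  then obtain s where s: "s < q" "X' \<subseteq> nbhd Z s Y'" "Y' \<subseteq> nbhd Z s X'"
    unfolding hausdorff_mdist_def Inf_less_iff by auto
  define S where "S x y \<longleftrightarrow> (\<exists>p\<in>X'. \<exists>q\<in>Y'. x = f p \<and> y = g q \<and> mdist Z p q < s)" for x y
  have "correspondence X Y S"
    unfolding correspondence_def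
  proof (intro conjI allI ballI impI)
    fix x assume "x \<in> mspace X"
    then obtain p where p: "p \<in> X'" "x = f p"
      using f(1) by (auto simp: bij_betw_def)
    then obtain q where "q \<in> Y'" "mdist Z q p < s"
      using s(2) by (auto simp: nbhd_def)
    then show "\<exists>y. S x y"
      using p unfolding S_def by (metis mdist_commute)
  next
    fix y assume "y \<in> mspace Y"
    then obtain q where q: "q \<in> Y'" "y = g q"
      using g(1) by (auto simp: bij_betw_def)
    then obtain p where "p \<in> X'" "mdist Z p q < s"
      using s(3) by (auto simp: nbhd_def)
    then show "\<exists>x. S x y"
      using q unfolding S_def by blast
  qed (use f(1) g(1) in \<open>auto simp: S_def bij_betw_def\<close>)
  moreover have "\<bar>mdist Y y y' - mdist X x x'\<bar> \<le> 2 * s" if xy: "S x y" "S x' y'" for x x' y y'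
  proof -
    obtain p q p' q' where *: "p \<in> X'" "q \<in> Y'" "p' \<in> X'" "q' \<in> Y'"
      "x = f p" "y = g q" "x' = f p'" "y' = g q'" "mdist Z p q < s" "mdist Z p' q' < s"
      using xy unfolding S_def by blast
    then have Z: "p \<in> mspace Z" "q \<in> mspace Z" "p' \<in> mspace Z" "q' \<in> mspace Z"
      using sub by auto
    have "mdist Z p p' \<le> mdist Z p q + mdist Z q p'" "mdist Z q p' \<le> mdist Z q q' + mdist Z q' p'"
      "mdist Z q q' \<le> mdist Z q p + mdist Z p q'" "mdist Z p q' \<le> mdist Z p p' + mdist Z p' q'"
      using Z by (auto intro: mdist_triangle)
    moreover have "mdist X x x' = mdist Z p p'" "mdist Y y y' = mdist Z q q'"
      using * f(2) g(2) by auto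
    ultimately show ?thesis
      using *(9,10) mdist_commute[of Z q p] mdist_commute[of Z q' p'] by linarith
  qed
  ultimately show ?thesis
    using that s(1) by blast
qed

section \<open>Change of scale by self-similarities\<close>

text \<open>The stabilizer always contains \<open>1\<close>, so a nontrivial one contains a factor different from \<open>1\<close>. If
  that factor is below \<open>1\<close>, the inverse of the corresponding bijection expands.\<close>

lemma expanding_similarity_of_stabilizer:
  assumes "stabilizer X \<noteq> {1}"
  obtains c f where "c > 1" "bij_betw f (mspace X) (mspace X)"
    "\<And>x y. x \<in> mspace X \<Longrightarrow> y \<in> mspace X \<Longrightarrow> mdist X (f x) (f y) = c * mdist X x y"
proof -
  have "1 \<in> stabilizer X"
    unfolding stabilizer_def isometric_def by (auto intro!: exI[of _ id])
  then obtain c where "c \<in> stabilizer X" "c \<noteq> 1"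
    using assms by blast
  then obtain f where "c > 0" and f: "bij_betw f (mspace X) (mspace X)"
    "\<And>x y. x \<in> mspace X \<Longrightarrow> y \<in> mspace X \<Longrightarrow> mdist X (f x) (f y) = c * mdist X x y"
    unfolding stabilizer_def isometric_def by auto
  show ?thesis
  proof (cases "c > 1")
    case True
    then show ?thesis using that f by blast
  next
    case False
    define g where "g = inv_into (mspace X) f"
    have g: "bij_betw g (mspace X) (mspace X)"
      unfolding g_def using f(1) by (rule bij_betw_inv_into)
    show ?thesis
    proof (rule that[OF _ g])
      show "1 / c > 1"
        using False \<open>c > 0\<close> \<open>c \<noteq> 1\<close> by simp
      fix x y assume xy: "x \<in> mspace X" "y \<in> mspace X"
      have "f (g x) = x" "f (g y) = y"
        using xy f(1) by (simp_all add: g_def bij_betw_inv_into_right)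
      moreover have "g x \<in> mspace X" "g y \<in> mspace X"
        using xy g by (auto simp: bij_betw_def)
      ultimately have "mdist X x y = c * mdist X (g x) (g y)"
        using f(2) by metis
      then show "mdist X (g x) (g y) = 1 / c * mdist X x y"
        using \<open>c > 0\<close> by simp
    qed
  qed
qed

lemma similarity_funpow:
  assumes f: "bij_betw f (mspace X) (mspace X)"
    and "\<And>x y. x \<in> mspace X \<Longrightarrow> y \<in> mspace X \<Longrightarrow> mdist X (f x) (f y) = c * mdist X x y"
    and "x \<in> mspace X" "y \<in> mspace X"
  shows "mdist X ((f ^^ N) x) ((f ^^ N) y) = c ^ N * mdist X x y"
proof (induction N)
  case (Suc N)
  have "(f ^^ N) z \<in> mspace X" if "z \<in> mspace X" for z
    using bij_betw_funpow[OF f, of N] that by (auto simp: bij_betw_def)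
  then show ?case
    using Suc assms(2-4) by simp
qed simp

text \<open>In the presence of an expanding self-similarity all positive scales are alike: a cover at one of
  them is spread out by the iterates to covers at arbitrarily large scales.\<close>

lemma asdim_le_of_layered_cover:
  assumes "stabilizer X \<noteq> {1}" "layered_cover X m d" "d > 0"
  shows "asdim_le X m"
  unfolding asdim_le_iff_layered_cover
proof
  fix r
  obtain c f where c: "c > 1" and f: "bij_betw f (mspace X) (mspace X)"
    "\<And>x y. x \<in> mspace X \<Longrightarrow> y \<in> mspace X \<Longrightarrow> mdist X (f x) (f y) = c * mdist X x y"
    using expanding_similarity_of_stabilizer[OF assms(1)] by metis
  obtain N where "r / d < c ^ N"
    using real_arch_pow[OF c] by blast
  \<comment> \<open>The subtracted \<open>0\<close> is the additive distortion: an exact similarity has none.\<close>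
  then have N: "r < c ^ N * d - 0"
    using \<open>d > 0\<close> by (simp add: field_simps)
  define S where "S x y \<longleftrightarrow> x \<in> mspace X \<and> y = (f ^^ N) x" for x y
  show "layered_cover X m r"
  proof (rule layered_cover_transport[OF assms(2) _ _ N])
    show "correspondence X X S"
      using bij_betw_funpow[OF f(1), of N] unfolding correspondence_def S_def bij_betw_def
      by blast
    show "c ^ N > 0"
      using c by simp
    show "\<bar>mdist X y y' - c ^ N * mdist X x x'\<bar> \<le> 0" if "S x y" "S x' y'" for x x' y y'
      using that similarity_funpow[OF f, of x x' N] by (simp add: S_def)
  qed
qed

section \<open>The lower bound\<close>

theorem theorem3:
  fixes X :: "'a metric" and A :: "'b metric" and r :: real and n k :: nat
    and \<U> :: "nat \<Rightarrow> 'b set set"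
  assumes "n \<ge> 1"
    and "mspace X \<noteq> {}" and "asdim_ge X n" and "stabilizer X \<noteq> {1}"
    and "mspace A \<noteq> {}"
    and "1 \<le> k" and "k \<le> n"
    and "\<And>i. i \<in> {1..k} \<Longrightarrow>
           subset_family A (\<U> i) \<and> r_disjoint A r (\<U> i) \<and> uniformly_bounded A (\<U> i)"
    and "\<And>a. a \<in> mspace A \<Longrightarrow> \<exists>i\<in>{1..k}. \<exists>U\<in>\<U> i. a \<in> U"
  shows "GH_dist A X \<ge> ereal (r / 2)"
proof (rule ccontr)
  assume "\<not> ?thesis"
  then have "GH_dist A X < ereal (r / 2)" by simp
  then obtain S s where s: "s < r / 2" and S: "correspondence A X S"
    "\<And>a a' x x'. S a x \<Longrightarrow> S a' x' \<Longrightarrow> \<bar>mdist X x x' - mdist A a a'\<bar> \<le> 2 * s"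
    by (rule correspondence_of_GH_dist_less) blast
  have "layered_cover A (k - 1) r"
    unfolding layered_cover_def
  proof (intro exI[of _ "\<lambda>i. \<U> (Suc i)"] conjI ballI)
    show "mspace A \<subseteq> \<Union>(\<Union>i\<in>{0..k - 1}. \<U> (Suc i))"
    proof
      fix a assume "a \<in> mspace A"
      then obtain i U where "i \<in> {1..k}" "U \<in> \<U> i" "a \<in> U"
        using assms(9) by blast
      then show "a \<in> \<Union>(\<Union>i\<in>{0..k - 1}. \<U> (Suc i))"
        by (auto intro!: bexI[of _ "i - 1"])
    qed
  qed (use assms(6,8) in auto)
  then have "layered_cover A (n - 1) r"
    using \<open>k \<le> n\<close> by (auto intro: layered_cover_mono)
  then have "layered_cover X (n - 1) ((r - 2 * s) / 2)"
  proof (rule layered_cover_transport[where c = 1 and e = "2 * s", OF _ S(1)])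
    show "(r - 2 * s) / 2 < 1 * r - 2 * s"
      using s by (simp add: field_simps)
    show "\<bar>mdist X x x' - 1 * mdist A a a'\<bar> \<le> 2 * s" if "S a x" "S a' x'" for a a' x x'
      using S(2)[OF that] by simp
  qed simp
  then have "asdim_le X (n - 1)"
    using assms(4) s by (intro asdim_le_of_layered_cover) auto
  then show False
    using assms(1,3) by (simp add: asdim_ge_def)
qed

end
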